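(* For every negative odd integer $k$ and every positive integer $n$, $a(n,k)=c^{-k}_{\text{even}}(n)$.
   Context: For an integer $k$, $A(n,k)$ is the set of compositions $(c_1,\ldots,c_t)$ of $n$ (finite sequences of positive integers summing to $n$) such that $c_{2i-1}>c_{2i}+k$ for every $i$ with $2i\le t$ (no condition on the last part if $t$ is odd), and $a(n,k)=|A(n,k)|$. For a nonnegative integer $j$, $C^{2j+1}_{\text{even}}(n)$ is the set of compositions of $n$ whose parts all lie in the set of positive even integers together with the odd integers $1,3,\ldots,2j+1$, and $c^{2j+1}_{\text{even}}(n)=|C^{2j+1}_{\text{even}}(n)|$. *)

theory Defs
  imports Main
begin

definition compositions :: "nat \<Rightarrow> nat list set" where
  "compositions n = {c. (\<forall>x \<in> set c. x > 0) \<and> sum_list c = n}"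

(* Lists are indexed from 0, so the pair (c_{2i-1}, c_{2i}) with i >= 1 and 2i <= t
   becomes (c ! (2*i), c ! (2*i+1)) with i >= 0 and 2*i+1 < length c.
   The comparison is made in int because k may be negative. *)
definition A :: "nat \<Rightarrow> int \<Rightarrow> nat list set" where
  "A n k = {c \<in> compositions n.
     \<forall>i. 2 * i + 1 < length c \<longrightarrow> int (c ! (2 * i)) > int (c ! (2 * i + 1)) + k}"

definition a :: "nat \<Rightarrow> int \<Rightarrow> nat" where
  "a n k = card (A n k)"

(* The first argument is the whole superscript m = 2j+1, not j;
   the definition is meant for odd m only. *)
definition C_even :: "nat \<Rightarrow> nat \<Rightarrow> nat list set" where
  "C_even m n = {c \<in> compositions n. set c \<subseteq> {x. x > 0 \<and> even x} \<union> {x. odd x \<and> x \<le> m}}"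

definition c_even :: "nat \<Rightarrow> nat \<Rightarrow> nat" where
  "c_even m n = card (C_even m n)"

lemma finite_compositions: "finite (compositions n)"
proof (rule finite_subset)
  have "length c \<le> sum_list c" if "\<forall>x \<in> set c. x > 0" for c :: "nat list"
    using that by (induction c) auto
  then show "compositions n \<subseteq> {c. set c \<subseteq> {..n} \<and> length c \<le> n}"
    by (auto simp: compositions_def member_le_sum_list)
  show "finite {c :: nat list. set c \<subseteq> {..n} \<and> length c \<le> n}"
    by (rule finite_lists_length_le) simp
qed

end

theory Submission
  imports Defs
begin

text \<open>
  Put \<open>m = -k\<close>, so that a composition belongs to \<open>A n k\<close> iff each pair \<open>(x, y)\<close> of consecutive
  parts satisfies \<open>y < x + m\<close>. Adding 1 to the first part preserves this condition, and the nonempty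
  compositions not obtained in this way begin with a pair \<open>(1, y)\<close>, \<open>y \<le> m\<close>, or
  \<open>(x, x + m - 1)\<close>, \<open>x \<ge> 2\<close>. The sums of these pairs are \<open>2, \<dots>, m + 1\<close> and the even numbers
  above \<open>m + 1\<close>, each occurring once: as \<open>m\<close> is odd, these are exactly the parts other than 1
  allowed in \<open>C_even m n\<close>. Reading a part 1 as the increment and any other part as the
  prefixing of the corresponding pair therefore gives a bijection.
\<close>

definition even_or_le :: "nat \<Rightarrow> nat set" where
  "even_or_le m = {s. s > 0 \<and> (even s \<or> s \<le> m)}"

fun pairs_within :: "nat \<Rightarrow> nat list \<Rightarrow> bool" where
  "pairs_within m (x # y # c) \<longleftrightarrow> y < x + m \<and> pairs_within m c"
| "pairs_within m _ \<longleftrightarrow> True"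

fun bump :: "nat list \<Rightarrow> nat list" where
  "bump [] = [1]"
| "bump (x # c) = Suc x # c"

text \<open>The second branch solves \<open>x + y = s\<close>, \<open>y = x + m - 1\<close>; for
  \<open>m\<close> odd and \<open>s\<close> even both divisions are exact.\<close>

definition pair_of_sum :: "nat \<Rightarrow> nat \<Rightarrow> nat \<times> nat" where
  "pair_of_sum m s =
     (if s \<le> m + 1 then (1, s - 1) else ((s + 1 - m) div 2, (s + m - 1) div 2))"

fun decode :: "nat \<Rightarrow> nat list \<Rightarrow> nat list" where
  "decode m [] = []"
| "decode m (s # w) =
     (if s = 1 then bump (decode m w)
      else fst (pair_of_sum m s) # snd (pair_of_sum m s) # decode m w)"

lemma pairs_within_iff_nth:
  "pairs_within m c \<longleftrightarrow> (\<forall>i. 2 * i + 1 < length c \<longrightarrow> c ! (2 * i + 1) < c ! (2 * i) + m)"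
proof (induction m c rule: pairs_within.induct)
  case (1 m x y c)
  \<comment> \<open>Index 0 is the leading pair; \<open>Suc i\<close> is index \<open>i\<close>
    after both of its parts are dropped.\<close>
  have "(\<forall>i. P i) \<longleftrightarrow> P 0 \<and> (\<forall>i. P (Suc i))" for P :: "nat \<Rightarrow> bool"
    using not0_implies_Suc by metis
  from this[of "\<lambda>i. 2 * i + 1 < length (x # y # c) \<longrightarrow>
      (x # y # c) ! (2 * i + 1) < (x # y # c) ! (2 * i) + m"]
  show ?case using 1 by simp
qed auto

lemma A_eq_pairs_within:
  assumes "k < 0"
  shows "A n k = {c \<in> compositions n. pairs_within (nat (- k)) c}"
proof -
  have "int u > int v + k \<longleftrightarrow> v < u + nat (- k)" for u v
    using assms by linarith
  then show ?thesis
    by (simp add: A_def pairs_within_iff_nth)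
qed

lemma C_even_eq_even_or_le:
  "C_even m n = {w. set w \<subseteq> even_or_le m \<and> sum_list w = n}"
  by (auto simp: C_even_def compositions_def even_or_le_def odd_pos)

lemma sum_list_bump [simp]: "sum_list (bump c) = Suc (sum_list c)"
  by (cases c) auto

lemma pairs_within_bump: "pairs_within m c \<Longrightarrow> pairs_within m (bump c)"
  by (cases "(m, c)" rule: pairs_within.cases) auto

lemma set_bump_pos: "0 \<notin> set c \<Longrightarrow> 0 \<notin> set (bump c)"
  by (cases c) auto

text \<open>Positivity excludes the one collision, \<open>bump [] = bump [0]\<close>.\<close>

lemma bump_inject:
  assumes "bump c = bump d" "0 \<notin> set c" "0 \<notin> set d"
  shows "c = d"
  using assms by (cases c; cases d) auto

text \<open>The last claim is irreducibility: lowering the first part by 1 would make it 0 or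
  violate the bound on the second part.\<close>

lemma pair_of_sum_props:
  assumes "odd m" "s \<in> even_or_le m" "s \<noteq> 1"
  shows "fst (pair_of_sum m s) > 0" "snd (pair_of_sum m s) > 0"
    and "fst (pair_of_sum m s) + snd (pair_of_sum m s) = s"
    and "snd (pair_of_sum m s) < fst (pair_of_sum m s) + m"
    and "fst (pair_of_sum m s) = 1 \<or> snd (pair_of_sum m s) + 1 = fst (pair_of_sum m s) + m"
  using assms by (auto simp: pair_of_sum_def even_or_le_def elim!: oddE evenE)

text \<open>Oddness of \<open>m\<close> matters at \<open>y = m\<close>: the sum
  \<open>m + 1\<close> exceeds \<open>m\<close> and is allowed only because it is even.\<close>

lemma pair_of_sum_1:
  assumes "odd m" "0 < y" "y \<le> m"
  shows "Suc y \<in> even_or_le m" "pair_of_sum m (Suc y) = (1, y)"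
  using assms by (auto simp: pair_of_sum_def even_or_le_def le_less)

text \<open>The sum is \<open>2 * x + m - 1\<close>, which is even and, as \<open>x \<ge> 2\<close>,
  lies above \<open>m + 1\<close>, so the second branch applies.\<close>

lemma pair_of_sum_extremal:
  assumes "odd m" "x \<ge> 2" "y + 1 = x + m"
  shows "x + y \<in> even_or_le m" "pair_of_sum m (x + y) = (x, y)"
  using assms by (auto simp: pair_of_sum_def even_or_le_def elim!: oddE)

lemma decode_props:
  assumes "odd m" "set w \<subseteq> even_or_le m"
  shows "sum_list (decode m w) = sum_list w" "0 \<notin> set (decode m w)"
    and "pairs_within m (decode m w)"
  using assms(2) pair_of_sum_props[OF assms(1)]
  by (induction w) (auto simp: set_bump_pos pairs_within_bump)

text \<open>If \<open>c\<close> has at most one part, its bump has only one. Otherwise the bump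
  starts with a part above 1 and stays strictly below the extremal bound, contrary to
  irreducibility.\<close>

lemma bump_neq_pair:
  assumes "odd m" "s \<in> even_or_le m" "s \<noteq> 1" "0 \<notin> set c" "pairs_within m c"
  shows "bump c \<noteq> fst (pair_of_sum m s) # snd (pair_of_sum m s) # d"
  using pair_of_sum_props(5)[OF assms(1-3)] assms(4,5)
  by (cases "(m, c)" rule: pairs_within.cases) auto

text \<open>The first letter can be read off: bumps and pairs never coincide, and a letter other
  than 1 is the sum of the first two parts. Cancelling it leaves equal decoded tails.\<close>

lemma decode_inject:
  assumes "odd m" "set v \<subseteq> even_or_le m" "set w \<subseteq> even_or_le m" "decode m v = decode m w"
  shows "v = w"
  using assms(2-)
proof (induction v arbitrary: w)
  case Nil
  then show ?case
    using decode_props(1)[OF assms(1), of w] by (cases w) (auto simp: even_or_le_def)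
next
  case (Cons s v)
  then obtain t w' where w: "w = t # w'"
    using decode_props(1)[OF assms(1), of "s # v"] by (cases w) (auto simp: even_or_le_def)
  have v: "0 \<notin> set (decode m v)" "pairs_within m (decode m v)"
    and w': "0 \<notin> set (decode m w')" "pairs_within m (decode m w')"
    using Cons.prems w decode_props[OF assms(1)] by auto
  have s: "s \<in> even_or_le m" and t: "t \<in> even_or_le m"
    using Cons.prems w by auto
  have eq: "decode m (s # v) = decode m (t # w')"
    using Cons.prems w by simp
  have "s = 1 \<longleftrightarrow> t = 1"
    using eq bump_neq_pair[OF assms(1) t _ v] bump_neq_pair[OF assms(1) s _ w']
    by (metis decode.simps(2))
  then consider "s = 1" "t = 1" | "s \<noteq> 1" "t \<noteq> 1" by blast
  then have "s = t \<and> decode m v = decode m w'"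
  proof cases
    case 1
    then show ?thesis using eq bump_inject v(1) w'(1) by simp
  next
    case 2
    then show ?thesis
      using eq pair_of_sum_props(3)[OF assms(1) s] pair_of_sum_props(3)[OF assms(1) t]
      by (metis decode.simps(2) list.inject)
  qed
  then show ?case using Cons w by auto
qed

text \<open>Strip off a bump or an irreducible pair. The induction is on the sum because undoing a
  bump need not shorten the list.\<close>

lemma decode_surj:
  assumes "odd m" "0 \<notin> set c" "pairs_within m c"
  shows "\<exists>w. set w \<subseteq> even_or_le m \<and> decode m w = c"
  using assms(2,3)
proof (induction "sum_list c" arbitrary: c rule: less_induct)
  case less
  have one: "1 \<in> even_or_le m"
    using assms(1) by (auto simp: even_or_le_def odd_pos Suc_le_eq)
  have bumped: ?case if d: "c = bump d" "0 \<notin> set d" "pairs_within m d" for d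
  proof -
    obtain w where "set w \<subseteq> even_or_le m" "decode m w = d"
      using less.hyps[OF _ d(2,3)] d(1) by auto
    then have "set (1 # w) \<subseteq> even_or_le m" "decode m (1 # w) = c"
      using d(1) one by auto
    then show ?thesis by blast
  qed
  have paired: ?case
    if c: "c = x # y # d" and s: "x + y \<in> even_or_le m" "pair_of_sum m (x + y) = (x, y)" for x y d
  proof -
    obtain w where "set w \<subseteq> even_or_le m" "decode m w = d"
      using less.hyps[of d] less.prems c by auto
    moreover have "x + y \<noteq> 1" using less.prems c by auto
    ultimately have "set ((x + y) # w) \<subseteq> even_or_le m" "decode m ((x + y) # w) = c"
      using s c by auto
    then show ?thesis by blast
  qed
  show ?case
  proof (cases "(m, c)" rule: pairs_within.cases)
    case (1 m' x y d)
    then have c: "c = x # y # d" and xy: "0 < x" "0 < y" "y < x + m"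
      using less.prems by auto
    \<comment> \<open>The first two cases are the irreducible pairs; in the third, \<open>x\<close>
      can be lowered by 1 within the bound.\<close>
    consider "x = 1" | "x \<ge> 2" "y + 1 = x + m" | "x \<ge> 2" "y < x - 1 + m"
      using xy by linarith
    then show ?thesis
    proof cases
      case 1
      then show ?thesis using paired[OF c] pair_of_sum_1[OF assms(1), of y] xy by simp
    next
      case 2
      then show ?thesis using paired[OF c] pair_of_sum_extremal[OF assms(1)] by simp
    next
      case 3
      then show ?thesis using bumped[of "(x - 1) # y # d"] less.prems c by auto
    qed
  next
    case ("2_1" m')
    then have "c = decode m []" by simp
    then show ?thesis by (metis empty_set empty_subsetI)
  next
    case ("2_2" m' x)
    \<comment> \<open>A lone part contains no pair, so it is built from bumps only, starting with
      \<open>bump [] = [1]\<close>.\<close>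
    show ?thesis
    proof (cases "x = 1")
      case True
      then show ?thesis using bumped[of "[]"] "2_2" by simp
    next
      case False
      then show ?thesis using bumped[of "[x - 1]"] "2_2" less.prems by auto
    qed
  qed
qed

lemma bij_betw_decode:
  assumes "odd m"
  shows "bij_betw (decode m) (C_even m n) {c \<in> compositions n. pairs_within m c}"
  unfolding bij_betw_def
proof (intro conjI equalityI subsetI)
  show "inj_on (decode m) (C_even m n)"
    using decode_inject[OF assms] by (auto simp: inj_on_def C_even_eq_even_or_le)
next
  fix c assume "c \<in> decode m ` C_even m n"
  then show "c \<in> {c \<in> compositions n. pairs_within m c}"
    using decode_props[OF assms]
    by (auto simp: C_even_eq_even_or_le compositions_def intro: gr0I)
next
  fix c assume "c \<in> {c \<in> compositions n. pairs_within m c}"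
  then have c: "0 \<notin> set c" "sum_list c = n" "pairs_within m c"
    by (auto simp: compositions_def)
  then obtain w where "set w \<subseteq> even_or_le m" "decode m w = c"
    using decode_surj[OF assms] by blast
  then show "c \<in> decode m ` C_even m n"
    using decode_props(1)[OF assms, of w] c(2) by (auto simp: C_even_eq_even_or_le)
qed

theorem theorem4p5:
  fixes k :: int and n :: nat
  assumes "k < 0" and "odd k" and "n > 0"
  shows "a n k = c_even (nat (- k)) n"
proof -
  have "odd (nat (- k))"
    using assms by (simp add: even_nat_iff)
  then show ?thesis
    using bij_betw_same_card[OF bij_betw_decode]
    by (simp add: a_def c_even_def A_eq_pairs_within[OF assms(1)])
qed

end
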